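(* Let $\Gamma$ be a countable group with a splitting $\Gamma=A\ast B$ into two non-trivial groups, such that $A$ contains an element of infinite order. For $1<p<\infty$ the split classes form an infinite-dimensional subspace of $\mathrm{H}^2_\mathrm{b}(\Gamma,\ell^p(\Gamma))$. If moreover $A$ is amenable, the same holds for $p=1$.
   Context: $\ell^p(\Gamma)$ carries the left-regular action $(g.\chi)(h)=\chi(g^{-1}h)$. For a Banach $\Gamma$-module $E$ (Banach space with linear isometric $\Gamma$-action), a quasicocycle is a map $f:\Gamma\to E$ with $\sup_{g,h}\|f(gh)-f(g)-g.f(h)\|<\infty$; it is alternating if $f(g)+g.f(g^{-1})=0$ for all $g$. $\mathrm{H}^*_\mathrm{b}(\Gamma,E)$ is the cohomology of the bounded bar complex; for a quasicocycle $f$, $\omega_f:=[\partial f]_\mathrm{b}\in\mathrm{H}^2_\mathrm{b}(\Gamma,E)$ where $\partial f(g,h)=f(g)+g.f(h)-f(gh)$. Each $1\neq g\in A\ast B$ has a unique normal form $g=a_1b_1\cdots a_nb_n$ ($a_i\in A$, $b_i\in B$, all non-trivial except possibly $a_1$ or $b_n$). For alternating quasicocycles $f_A:A\to E$, $f_B:B\to E$ the split quasicocycle is $(f_A\ast f_B)(1)=0$, $(f_A\ast f_B)(a_1b_1\cdots a_nb_n)=f_A(a_1)+a_1.f_B(b_1)+a_1b_1.f_A(a_2)+\dots+a_1b_1\cdots b_{n-1}a_n.f_B(b_n)$. The split classes are the classes $\omega_{f_A\ast f_B}$, i.e. the image of the linear map $(f_A,f_B)\mapsto\omega_{f_A\ast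 f_B}$. *)

theory Defs
  imports "HOL-Analysis.Analysis" "HOL-Algebra.Algebra"
begin

definition lp :: "('g, 'b) monoid_scheme \<Rightarrow> real \<Rightarrow> ('g \<Rightarrow> real) set" where
  "lp G p = {u. (\<forall>x. x \<notin> carrier G \<longrightarrow> u x = 0) \<and>
                 (\<lambda>x. \<bar>u x\<bar> powr p) summable_on carrier G}"

definition lp_norm :: "('g, 'b) monoid_scheme \<Rightarrow> real \<Rightarrow> ('g \<Rightarrow> real) \<Rightarrow> real" where
  "lp_norm G p u = (\<Sum>\<^sub>\<infinity>x\<in>carrier G. \<bar>u x\<bar> powr p) powr (1 / p)"

definition lreg_act :: "('g, 'b) monoid_scheme \<Rightarrow> 'g \<Rightarrow> ('g \<Rightarrow> real) \<Rightarrow> ('g \<Rightarrow> real)" where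
  "lreg_act G g u = (\<lambda>x. if x \<in> carrier G then u (inv\<^bsub>G\<^esub> g \<otimes>\<^bsub>G\<^esub> x) else 0)"

definition quasicocycle :: "('g, 'b) monoid_scheme \<Rightarrow> real \<Rightarrow> 'g set \<Rightarrow> ('g \<Rightarrow> 'g \<Rightarrow> real) \<Rightarrow> bool" where
  "quasicocycle G p S f \<longleftrightarrow>
     (\<forall>g\<in>S. f g \<in> lp G p) \<and>
     (\<exists>C. \<forall>g\<in>S. \<forall>h\<in>S.
        lp_norm G p (\<lambda>x. f (g \<otimes>\<^bsub>G\<^esub> h) x - f g x - lreg_act G g (f h) x) \<le> C)"

definition alternating :: "('g, 'b) monoid_scheme \<Rightarrow> 'g set \<Rightarrow> ('g \<Rightarrow> 'g \<Rightarrow> real) \<Rightarrow> bool" where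
  "alternating G S f \<longleftrightarrow> (\<forall>g\<in>S. (\<lambda>x. f g x + lreg_act G g (f (inv\<^bsub>G\<^esub> g)) x) = (\<lambda>x. 0))"

text \<open>Normal forms in A * B: a word [(a1,b1),...,(an,bn)] stands for a1 b1 ... an bn,
  with a_i in A, b_i in B, all non-trivial except possibly a1 and bn, and not the empty
  product (the word [(1,1)] is excluded).\<close>
definition nf_word :: "('g, 'b) monoid_scheme \<Rightarrow> 'g set \<Rightarrow> 'g set \<Rightarrow> ('g \<times> 'g) list \<Rightarrow> bool" where
  "nf_word G A B w \<longleftrightarrow> w \<noteq> [] \<and>
     (\<forall>i<length w. fst (w ! i) \<in> A \<and> snd (w ! i) \<in> B \<and>
        (0 < i \<longrightarrow> fst (w ! i) \<noteq> \<one>\<^bsub>G\<^esub>) \<and>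
        (i < length w - 1 \<longrightarrow> snd (w ! i) \<noteq> \<one>\<^bsub>G\<^esub>)) \<and>
     (length w = 1 \<longrightarrow> w ! 0 \<noteq> (\<one>\<^bsub>G\<^esub>, \<one>\<^bsub>G\<^esub>))"

fun word_prod :: "('g, 'b) monoid_scheme \<Rightarrow> ('g \<times> 'g) list \<Rightarrow> 'g" where
  "word_prod G [] = \<one>\<^bsub>G\<^esub>"
| "word_prod G ((a, b) # w) = a \<otimes>\<^bsub>G\<^esub> (b \<otimes>\<^bsub>G\<^esub> word_prod G w)"

definition free_product :: "('g, 'b) monoid_scheme \<Rightarrow> 'g set \<Rightarrow> 'g set \<Rightarrow> bool" where
  "free_product G A B \<longleftrightarrow> subgroup A G \<and> subgroup B G \<and>
     (\<forall>g\<in>carrier G. g \<noteq> \<one>\<^bsub>G\<^esub> \<longrightarrow> (\<exists>!w. nf_word G A B w \<and> word_prod G w = g)) \<and>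
     (\<forall>w. nf_word G A B w \<longrightarrow> word_prod G w \<noteq> \<one>\<^bsub>G\<^esub>)"

fun split_word :: "('g, 'b) monoid_scheme \<Rightarrow> ('g \<Rightarrow> 'g \<Rightarrow> real) \<Rightarrow> ('g \<Rightarrow> 'g \<Rightarrow> real)
                    \<Rightarrow> ('g \<times> 'g) list \<Rightarrow> ('g \<Rightarrow> real)" where
  "split_word G fA fB [] = (\<lambda>x. 0)"
| "split_word G fA fB ((a, b) # w) =
     (\<lambda>x. fA a x + lreg_act G a (fB b) x
          + lreg_act G (a \<otimes>\<^bsub>G\<^esub> b) (split_word G fA fB w) x)"

definition split_qc :: "('g, 'b) monoid_scheme \<Rightarrow> 'g set \<Rightarrow> 'g set \<Rightarrow> ('g \<Rightarrow> 'g \<Rightarrow> real)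
                        \<Rightarrow> ('g \<Rightarrow> 'g \<Rightarrow> real) \<Rightarrow> 'g \<Rightarrow> ('g \<Rightarrow> real)" where
  "split_qc G A B fA fB g =
     (if g = \<one>\<^bsub>G\<^esub> then (\<lambda>x. 0)
      else split_word G fA fB (THE w. nf_word G A B w \<and> word_prod G w = g))"

definition qc_boundary :: "('g, 'b) monoid_scheme \<Rightarrow> ('g \<Rightarrow> 'g \<Rightarrow> real) \<Rightarrow> 'g \<Rightarrow> 'g \<Rightarrow> ('g \<Rightarrow> real)" where
  "qc_boundary G f g h = (\<lambda>x. f g x + lreg_act G g (f h) x - f (g \<otimes>\<^bsub>G\<^esub> h) x)"

text \<open>A bounded 2-cochain is a coboundary in the bounded bar complex with values in l^p:
  it is delta(beta) for a bounded 1-cochain beta, where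
  delta(beta)(g,h) = g.beta(h) - beta(gh) + beta(g).  Such omega represent 0 in H^2_b.\<close>
definition bounded_exact :: "('g, 'b) monoid_scheme \<Rightarrow> real \<Rightarrow> ('g \<Rightarrow> 'g \<Rightarrow> ('g \<Rightarrow> real)) \<Rightarrow> bool" where
  "bounded_exact G p \<omega> \<longleftrightarrow>
     (\<exists>\<beta>. (\<forall>g\<in>carrier G. \<beta> g \<in> lp G p) \<and>
          (\<exists>C. \<forall>g\<in>carrier G. lp_norm G p (\<beta> g) \<le> C) \<and>
          (\<forall>g\<in>carrier G. \<forall>h\<in>carrier G.
             \<omega> g h = (\<lambda>x. lreg_act G g (\<beta> h) x - \<beta> (g \<otimes>\<^bsub>G\<^esub> h) x + \<beta> g x)))"

text \<open>The bounded 2-cocycle representing the split class omega_{f_A * f_B}.\<close>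
definition split_class :: "('g, 'b) monoid_scheme \<Rightarrow> 'g set \<Rightarrow> 'g set \<Rightarrow> ('g \<Rightarrow> 'g \<Rightarrow> real)
                           \<Rightarrow> ('g \<Rightarrow> 'g \<Rightarrow> real) \<Rightarrow> 'g \<Rightarrow> 'g \<Rightarrow> ('g \<Rightarrow> real)" where
  "split_class G A B fA fB = qc_boundary G (split_qc G A B fA fB)"

definition split_pair :: "('g, 'b) monoid_scheme \<Rightarrow> 'g set \<Rightarrow> 'g set \<Rightarrow> real
                          \<Rightarrow> ('g \<Rightarrow> 'g \<Rightarrow> real) \<Rightarrow> ('g \<Rightarrow> 'g \<Rightarrow> real) \<Rightarrow> bool" where
  "split_pair G A B p fA fB \<longleftrightarrow>
     quasicocycle G p A fA \<and> alternating G A fA \<and> quasicocycle G p B fB \<and> alternating G B fB"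

definition split_classes_subspace :: "('g, 'b) monoid_scheme \<Rightarrow> 'g set \<Rightarrow> 'g set \<Rightarrow> real \<Rightarrow> bool" where
  "split_classes_subspace G A B p \<longleftrightarrow>
     (\<forall>fA fB fA' fB' (c::real) (d::real).
        split_pair G A B p fA fB \<and> split_pair G A B p fA' fB' \<longrightarrow>
        (\<exists>hA hB. split_pair G A B p hA hB \<and>
           bounded_exact G p (\<lambda>g h x. split_class G A B hA hB g h x
              - (c * split_class G A B fA fB g h x + d * split_class G A B fA' fB' g h x))))"

definition split_classes_infinite_dim :: "('g, 'b) monoid_scheme \<Rightarrow> 'g set \<Rightarrow> 'g set \<Rightarrow> real \<Rightarrow> bool" where
  "split_classes_infinite_dim G A B p \<longleftrightarrow>
     (\<forall>n::nat. \<exists>FA FB :: nat \<Rightarrow> 'g \<Rightarrow> 'g \<Rightarrow> real.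
        (\<forall>i<n. split_pair G A B p (FA i) (FB i)) \<and>
        (\<forall>c :: nat \<Rightarrow> real.
           bounded_exact G p (\<lambda>g h x. \<Sum>i<n. c i * split_class G A B (FA i) (FB i) g h x)
           \<longrightarrow> (\<forall>i<n. c i = 0)))"

definition amenable :: "('g, 'b) monoid_scheme \<Rightarrow> 'g set \<Rightarrow> bool" where
  "amenable G A \<longleftrightarrow>
     (\<exists>m :: ('g \<Rightarrow> real) \<Rightarrow> real.
        (\<forall>\<phi> \<psi>. bounded (\<phi> ` A) \<and> bounded (\<psi> ` A) \<longrightarrow> m (\<lambda>x. \<phi> x + \<psi> x) = m \<phi> + m \<psi>) \<and>
        (\<forall>\<phi> c. bounded (\<phi> ` A) \<longrightarrow> m (\<lambda>x. c * \<phi> x) = c * m \<phi>) \<and>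
        (\<forall>\<phi>. bounded (\<phi> ` A) \<and> (\<forall>x\<in>A. 0 \<le> \<phi> x) \<longrightarrow> 0 \<le> m \<phi>) \<and>
        m (\<lambda>x. 1) = 1 \<and>
        (\<forall>\<phi> a. bounded (\<phi> ` A) \<and> a \<in> A \<longrightarrow> m (\<lambda>x. \<phi> (a \<otimes>\<^bsub>G\<^esub> x)) = m \<phi>))"

end

theory Submission
  imports Defs "HOL-Complex_Analysis.Great_Picard"
begin

text \<open>
  Let \<open>t \<in> A\<close> have infinite order, let \<open>1 \<noteq> b \<in> B\<close>, and take \<open>f\<^sub>B = 0\<close> and \<open>f\<^sub>A\<close> bounded with
  finite support in the powers of \<open>t\<close>. If the class of \<open>F = f\<^sub>A * 0\<close> vanishes, then \<open>F\<close> is at bounded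
  distance from a cocycle \<open>c\<close>. As \<open>c\<close> is bounded on the cyclic group generated by \<open>t\<close>, it is inner there,
  so after subtracting a coboundary \<open>c\<close> vanishes on the powers of \<open>t\<close>. For large \<open>m\<close> the value
  of \<open>F - c\<close> at \<open>(t\<^sup>m b)\<^sup>k\<close> is then a sum of \<open>k\<close> nearly disjoint translates of \<open>- c(b)\<close>, and its
  boundedness in \<open>k\<close> forces \<open>c(b) = 0\<close>. Hence \<open>F\<close> itself is bounded on all elements \<open>(t\<^sup>m b)\<^sup>k\<close>, where
  it is a sum of \<open>k\<close> translates of \<open>f\<^sub>A(t\<^sup>m)\<close>; for point masses these are disjoint, so
  \<open>f\<^sub>A(t\<^sup>m) = 0\<close>.
\<close>

section \<open>Balls in l^p through finite partial sums\<close>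

text \<open>\<open>K\<close> bounds sums of p-th powers, so it is the p-th power of a norm bound.
  Testing finite subsets turns later estimates into inequalities between finite sums.\<close>

definition lp_ball :: "('g, 'b) monoid_scheme \<Rightarrow> real \<Rightarrow> real \<Rightarrow> ('g \<Rightarrow> real) set" where
  "lp_ball G p K = {u. (\<forall>x. x \<notin> carrier G \<longrightarrow> u x = 0) \<and>
     (\<forall>F. finite F \<and> F \<subseteq> carrier G \<longrightarrow> (\<Sum>x\<in>F. \<bar>u x\<bar> powr p) \<le> K)}"

lemma lp_ball_iff:
  assumes "p > 0" "0 \<le> C"
  shows "u \<in> lp_ball G p (C powr p) \<longleftrightarrow> u \<in> lp G p \<and> lp_norm G p u \<le> C"
proof
  assume u: "u \<in> lp_ball G p (C powr p)"
  have sm: "(\<lambda>x. \<bar>u x\<bar> powr p) summable_on carrier G"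
    by (rule nonneg_bdd_above_summable_on) (use u in \<open>auto simp: lp_ball_def bdd_above_def\<close>)
  have "(\<Sum>\<^sub>\<infinity>x\<in>carrier G. \<bar>u x\<bar> powr p) \<le> C powr p"
    by (rule infsum_le_finite_sums[OF sm]) (use u in \<open>auto simp: lp_ball_def\<close>)
  then have "lp_norm G p u \<le> (C powr p) powr (1 / p)"
    unfolding lp_norm_def using assms by (intro powr_mono2) (auto intro: infsum_nonneg)
  then show "u \<in> lp G p \<and> lp_norm G p u \<le> C"
    using sm u assms by (auto simp: lp_def lp_ball_def powr_powr)
next
  assume u: "u \<in> lp G p \<and> lp_norm G p u \<le> C"
  let ?E = "\<Sum>\<^sub>\<infinity>x\<in>carrier G. \<bar>u x\<bar> powr p"
  have "?E = lp_norm G p u powr p"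
    using assms by (simp add: lp_norm_def powr_powr infsum_nonneg)
  also have "\<dots> \<le> C powr p"
    using u assms by (intro powr_mono2) (auto simp: lp_norm_def)
  finally have E: "?E \<le> C powr p" .
  have "(\<Sum>x\<in>F. \<bar>u x\<bar> powr p) \<le> C powr p" if "finite F" "F \<subseteq> carrier G" for F
    using finite_sum_le_infsum[of "\<lambda>x. \<bar>u x\<bar> powr p" "carrier G" F] u that E
    by (force simp: lp_def)
  then show "u \<in> lp_ball G p (C powr p)"
    using u by (auto simp: lp_ball_def lp_def)
qed

lemma lp_ballD:
  "u \<in> lp_ball G p K \<Longrightarrow> finite F \<Longrightarrow> F \<subseteq> carrier G \<Longrightarrow> (\<Sum>x\<in>F. \<bar>u x\<bar> powr p) \<le> K"
  by (simp add: lp_ball_def)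

lemma lp_ball_radius_nonneg: "u \<in> lp_ball G p K \<Longrightarrow> 0 \<le> K"
  by (auto simp: lp_ball_def dest: spec[of _ "{}"])

lemma lp_ball_imp_lp:
  assumes "u \<in> lp_ball G p K" "p > 0"
  shows "u \<in> lp G p" "lp_norm G p u \<le> K powr (1 / p)"
  using assms lp_ball_iff[of p "K powr (1 / p)" u G] lp_ball_radius_nonneg[OF assms(1)]
  by (auto simp: powr_powr)

lemma lp_imp_lp_ball:
  assumes "u \<in> lp G p" "lp_norm G p u \<le> C" "p > 0"
  shows "u \<in> lp_ball G p (\<bar>C\<bar> powr p)"
  using assms lp_ball_iff[of p "\<bar>C\<bar>" u G] by auto

text \<open>Replacing both summands by the larger one costs the factor \<open>2 powr p\<close>. This
  is harmless where a fixed number of balls is added and only boundedness matters.\<close>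

lemma abs_add_powr_le:
  fixes a b p :: real
  assumes "p \<ge> 0"
  shows "\<bar>a + b\<bar> powr p \<le> 2 powr p * (\<bar>a\<bar> powr p + \<bar>b\<bar> powr p)"
proof -
  have "\<bar>a + b\<bar> powr p \<le> (2 * max \<bar>a\<bar> \<bar>b\<bar>) powr p"
    using assms by (intro powr_mono2) auto
  also have "\<dots> = 2 powr p * (max \<bar>a\<bar> \<bar>b\<bar> powr p)"
    by (rule powr_mult)
  also have "\<dots> \<le> 2 powr p * (\<bar>a\<bar> powr p + \<bar>b\<bar> powr p)"
    by (intro mult_left_mono) (auto simp: max_def)
  finally show ?thesis .
qed

lemma lp_ball_add:
  assumes "u \<in> lp_ball G p K" "v \<in> lp_ball G p L" "p \<ge> 0"
  shows "(\<lambda>x. u x + v x) \<in> lp_ball G p (2 powr p * (K + L))"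
proof -
  have "(\<Sum>x\<in>F. \<bar>u x + v x\<bar> powr p) \<le> 2 powr p * (K + L)" if "finite F" "F \<subseteq> carrier G" for F
  proof -
    have "(\<Sum>x\<in>F. \<bar>u x + v x\<bar> powr p) \<le> (\<Sum>x\<in>F. 2 powr p * (\<bar>u x\<bar> powr p + \<bar>v x\<bar> powr p))"
      by (intro sum_mono abs_add_powr_le assms)
    also have "\<dots> = 2 powr p * ((\<Sum>x\<in>F. \<bar>u x\<bar> powr p) + (\<Sum>x\<in>F. \<bar>v x\<bar> powr p))"
      by (simp only: sum_distrib_left[symmetric] sum.distrib)
    also have "\<dots> \<le> 2 powr p * (K + L)"
      using assms that by (intro mult_left_mono add_mono) (auto simp: lp_ball_def)
    finally show ?thesis .
  qed
  with assms show ?thesis by (auto simp: lp_ball_def)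
qed

lemma lp_ball_scale:
  assumes "u \<in> lp_ball G p K"
  shows "(\<lambda>x. c * u x) \<in> lp_ball G p (\<bar>c\<bar> powr p * K)"
  using assms
  by (auto simp: lp_ball_def abs_mult powr_mult sum_distrib_left[symmetric] intro!: mult_left_mono)

lemma lp_ball_diff:
  assumes "u \<in> lp_ball G p K" "v \<in> lp_ball G p L" "p \<ge> 0"
  shows "(\<lambda>x. u x - v x) \<in> lp_ball G p (2 powr p * (K + L))"
  using lp_ball_add[OF assms(1) lp_ball_scale[OF assms(2), of "- 1"] assms(3)] by simp

lemma (in group) lp_ball_translate:
  assumes "u \<in> lp_ball G p K" "g \<in> carrier G"
  shows "lreg_act G g u \<in> lp_ball G p K"
proof -
  have "(\<Sum>x\<in>F. \<bar>lreg_act G g u x\<bar> powr p) \<le> K" if F: "finite F" "F \<subseteq> carrier G" for F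
  proof -
    have inj: "inj_on (\<lambda>x. inv g \<otimes> x) F"
      using F assms(2) by (intro inj_onI) (metis inv_closed l_cancel subsetD)
    have "(\<Sum>x\<in>F. \<bar>lreg_act G g u x\<bar> powr p) = (\<Sum>x\<in>F. \<bar>u (inv g \<otimes> x)\<bar> powr p)"
      using F by (intro sum.cong) (auto simp: lreg_act_def)
    also have "\<dots> = (\<Sum>x\<in>(\<lambda>x. inv g \<otimes> x) ` F. \<bar>u x\<bar> powr p)"
      using inj by (simp add: sum.reindex o_def)
    also have "\<dots> \<le> K"
      by (rule lp_ballD[OF assms(1)]) (use F assms(2) in auto)
    finally show ?thesis .
  qed
  then show ?thesis by (simp add: lp_ball_def lreg_act_def)
qed

lemma lp_ball_card_le:
  assumes "u \<in> lp_ball G p K" "finite F" "F \<subseteq> carrier G" "\<And>x. x \<in> F \<Longrightarrow> e \<le> \<bar>u x\<bar>"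
    and "0 \<le> e" "0 \<le> p"
  shows "real (card F) * e powr p \<le> K"
proof -
  have "real (card F) * e powr p = (\<Sum>x\<in>F. e powr p)" by simp
  also have "\<dots> \<le> (\<Sum>x\<in>F. \<bar>u x\<bar> powr p)"
    using assms by (intro sum_mono powr_mono2) auto
  also have "\<dots> \<le> K" using assms by (auto simp: lp_ball_def)
  finally show ?thesis .
qed

text \<open>Chebyshev's inequality: every point of the set costs at least \<open>e powr p\<close>,
  so finite subsets have at most \<open>K / e powr p\<close> points.\<close>

lemma lp_ball_finite_superlevel:
  assumes "u \<in> lp_ball G p K" "0 < e" "0 \<le> p"
  shows "finite {x \<in> carrier G. e \<le> \<bar>u x\<bar>}"
proof (rule conjunct1[OF finite_if_finite_subsets_card_bdd])
  show "card F \<le> nat \<lceil>K / e powr p\<rceil>" if "F \<subseteq> {x \<in> carrier G. e \<le> \<bar>u x\<bar>}" "finite F" for F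
  proof -
    have "real (card F) * e powr p \<le> K"
      using lp_ball_card_le[OF assms(1) that(2), of e] that assms by auto
    then have "real (card F) \<le> K / e powr p"
      using assms by (simp add: field_simps)
    then show ?thesis by linarith
  qed
qed

section \<open>Convexity, averages and pointwise limits\<close>

text \<open>For positive arguments this is \<open>powr_convex\<close>; if an argument is 0, it
  reduces to \<open>s powr p \<le> s\<close> for \<open>0 < s < 1\<close>.\<close>

lemma powr_convex_nonneg:
  fixes p :: real
  assumes "p \<ge> 1"
  shows "convex_on {0..} (\<lambda>x. x powr p)"
proof (rule convex_onI)
  have scale: "(s * x) powr p \<le> s * x powr p" if "0 < s" "s < 1" for s x :: real
  proof -
    have "s powr p \<le> s powr 1"
      using that assms by (intro powr_mono') auto
    with that show ?thesis
      by (simp add: powr_mult mult_right_mono)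
  qed
  fix s x y :: real
  assume s: "0 < s" "s < 1" and xy: "x \<in> {0..}" "y \<in> {0..}"
  show "((1 - s) *\<^sub>R x + s *\<^sub>R y) powr p \<le> (1 - s) * x powr p + s * y powr p"
  proof (cases "x = 0 \<or> y = 0")
    case True
    then show ?thesis using scale[of s y] scale[of "1 - s" x] s by auto
  next
    case False
    then show ?thesis
      using convex_onD[OF powr_convex[OF assms], of s x y] s xy by auto
  qed
qed auto

text \<open>Jensen's inequality with equal weights \<open>1 / n\<close>.\<close>

lemma abs_mean_powr_le:
  fixes s :: "nat \<Rightarrow> real"
  assumes "p \<ge> 1" "0 < n"
  shows "\<bar>(\<Sum>i<n. s i) / n\<bar> powr p \<le> (\<Sum>i<n. \<bar>s i\<bar> powr p) / n"
proof -
  have "\<bar>(\<Sum>i<n. s i) / n\<bar> powr p \<le> (\<Sum>i<n. (1 / n) *\<^sub>R \<bar>s i\<bar>) powr p"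
    using assms by (intro powr_mono2)
      (auto simp: abs_divide sum_divide_distrib[symmetric] divide_right_mono)
  also have "\<dots> \<le> (\<Sum>i<n. 1 / n * \<bar>s i\<bar> powr p)"
    using assms by (intro convex_on_sum[OF _ _ powr_convex_nonneg[OF assms(1)]]) auto
  also have "\<dots> = (\<Sum>i<n. \<bar>s i\<bar> powr p) / n"
    by (simp add: sum_divide_distrib)
  finally show ?thesis .
qed

text \<open>Convexity preserves the radius \<open>K\<close> itself, whereas iterating
  \<open>lp_ball_add\<close> would make it grow with \<open>n\<close>. Cesaro means thus stay in one
  fixed ball.\<close>

lemma lp_ball_mean:
  assumes "\<And>i::nat. S i \<in> lp_ball G p K" "p \<ge> 1" "0 < n"
  shows "(\<lambda>x. (\<Sum>i<n. S i x) / n) \<in> lp_ball G p K"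
proof -
  have "(\<Sum>x\<in>F. \<bar>(\<Sum>i<n. S i x) / n\<bar> powr p) \<le> K" if F: "finite F" "F \<subseteq> carrier G" for F
  proof -
    have "(\<Sum>x\<in>F. \<bar>(\<Sum>i<n. S i x) / n\<bar> powr p) \<le> (\<Sum>x\<in>F. (\<Sum>i<n. \<bar>S i x\<bar> powr p) / n)"
      by (intro sum_mono abs_mean_powr_le assms)
    also have "\<dots> = (\<Sum>i<n. \<Sum>x\<in>F. \<bar>S i x\<bar> powr p) / n"
      by (subst sum.swap) (simp add: sum_divide_distrib)
    also have "\<dots> \<le> (\<Sum>i<n. K) / n"
      using assms(1) F by (intro divide_right_mono sum_mono) (auto simp: lp_ball_def)
    also have "\<dots> = K" using assms by simp
    finally show ?thesis .
  qed
  with assms show ?thesis by (auto simp: lp_ball_def)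
qed

lemma lp_ball_pointwise_bound:
  assumes "u \<in> lp_ball G p K" "p > 0"
  shows "\<bar>u x\<bar> \<le> K powr (1 / p)"
proof (cases "x \<in> carrier G")
  case True
  then have "\<bar>u x\<bar> powr p \<le> K"
    using assms by (auto simp: lp_ball_def dest: spec[of _ "{x}"])
  then have "(\<bar>u x\<bar> powr p) powr (1 / p) \<le> K powr (1 / p)"
    using assms by (intro powr_mono2) auto
  then show ?thesis using assms by (simp add: powr_powr)
qed (use assms in \<open>auto simp: lp_ball_def\<close>)

text \<open>An elementary form of Fatou's lemma: each finite partial sum passes to the
  limit.\<close>

lemma lp_ball_pointwise_limit:
  assumes "\<And>n. S n \<in> lp_ball G p K" "p > 0"
    and "\<And>x. x \<in> carrier G \<Longrightarrow> (\<lambda>n. S n x) \<longlonglongrightarrow> v x" "\<And>x. x \<notin> carrier G \<Longrightarrow> v x = 0"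
  shows "v \<in> lp_ball G p K"
proof -
  have "(\<Sum>x\<in>F. \<bar>v x\<bar> powr p) \<le> K" if F: "finite F" "F \<subseteq> carrier G" for F
  proof (rule LIMSEQ_le_const2)
    show "(\<lambda>n. \<Sum>x\<in>F. \<bar>S n x\<bar> powr p) \<longlonglongrightarrow> (\<Sum>x\<in>F. \<bar>v x\<bar> powr p)"
      using F assms by (intro tendsto_sum tendsto_powr' tendsto_rabs) auto
    show "\<exists>N. \<forall>n\<ge>N. (\<Sum>x\<in>F. \<bar>S n x\<bar> powr p) \<le> K"
      using F assms(1) by (auto simp: lp_ball_def)
  qed
  with assms(4) show ?thesis by (auto simp: lp_ball_def)
qed

section \<open>Bounded cocycles on cyclic groups\<close>

lemma (in group) inv_pow_Suc_mult:
  assumes "g \<in> carrier G" "x \<in> carrier G"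
  shows "inv (g [^] Suc n) \<otimes> x = inv (g [^] n) \<otimes> (inv g \<otimes> x)"
  unfolding nat_pow_Suc2[OF assms(1)] using assms by (simp add: inv_mult_group m_assoc)

text \<open>A bounded cocycle on a cyclic group is inner: a subsequential pointwise limit of its Cesaro
  means is a fixed point of the associated affine action.\<close>

lemma (in group) bounded_cyclic_cocycle_inner:
  assumes "p \<ge> 1" and "countable (carrier G)" and t: "t \<in> carrier G"
    and S: "\<And>n::nat. S n \<in> lp_ball G p K"
    and rec: "\<And>n x. x \<in> carrier G \<Longrightarrow> S (Suc n) x = S 1 x + S n (inv t \<otimes> x)"
  obtains v where "v \<in> lp_ball G p K"
    and "\<And>n x. x \<in> carrier G \<Longrightarrow> S n x = v x - v (inv (t [^] n) \<otimes> x)"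
proof -
  define M where "M n x = (\<Sum>i<Suc n. S i x) / real (Suc n)" for n x
  have M: "M n \<in> lp_ball G p K" for n
    unfolding M_def using lp_ball_mean[of S, OF S assms(1), of "Suc n"] by blast
  have "norm (M n x) \<le> K powr (1 / p)" for n x
    using lp_ball_pointwise_bound[OF M] assms(1) by simp
  \<comment> \<open>Uniformly bounded functions on a countable set have a subsequence that converges
    at every point, by a diagonal argument.\<close>
  then obtain k :: "nat \<Rightarrow> nat" where k: "strict_mono k"
    and conv: "\<And>x. x \<in> carrier G \<Longrightarrow> \<exists>l. (\<lambda>n. M (k n) x) \<longlonglongrightarrow> l"
    using function_convergent_subsequence[OF assms(2), of M] by metis
  define v where "v x = (if x \<in> carrier G then lim (\<lambda>n. M (k n) x) else 0)" for x
  have lim: "(\<lambda>n. M (k n) x) \<longlonglongrightarrow> v x" if "x \<in> carrier G" for x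
    using conv[OF that] that by (auto simp: v_def convergent_LIMSEQ_iff[symmetric] convergent_def)
  have v: "v \<in> lp_ball G p K"
    by (rule lp_ball_pointwise_limit[OF M _ lim]) (use assms(1) in \<open>auto simp: v_def\<close>)
  have aux: "P + Q - R = n * s + T \<Longrightarrow> 0 < n \<Longrightarrow> P / n - T / n = s - (Q - R) / n"
    for P Q R T s n :: real
    by (simp add: field_simps)
  \<comment> \<open>The recursion telescopes: the mean \<open>M n\<close> and its image under the
    affine map sending \<open>u\<close> to \<open>S 1 + t.u\<close> differ by
    \<open>(S (Suc n) - S 0) / Suc n\<close>. This tends to 0, so the limit \<open>v\<close> is a
    fixed point.\<close>
  have one: "v x - v (inv t \<otimes> x) = S 1 x" if x: "x \<in> carrier G" for x
  proof -
    have "(\<Sum>i<Suc n. S i x) + S (Suc n) x - S 0 x = real (Suc n) * S 1 x + (\<Sum>i<Suc n. S i (inv t \<otimes> x))"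
      for n
    proof -
      have "(\<Sum>i<Suc n. S i x) + S (Suc n) x = S 0 x + (\<Sum>i<Suc n. S (Suc i) x)"
        using sum.lessThan_Suc_shift[of "\<lambda>i. S i x" "Suc n"] sum.lessThan_Suc[of "\<lambda>i. S i x" "Suc n"]
        by linarith
      also have "(\<Sum>i<Suc n. S (Suc i) x) = real (Suc n) * S 1 x + (\<Sum>i<Suc n. S i (inv t \<otimes> x))"
        by (simp only: rec[OF x] sum.distrib sum_constant card_lessThan)
      finally show ?thesis by simp
    qed
    then have eq: "M n x - M n (inv t \<otimes> x) = S 1 x - (S (Suc n) x - S 0 x) / real (Suc n)" for n
      unfolding M_def by (rule aux) simp
    have "(\<lambda>n. (S (Suc n) x - S 0 x) / real (Suc n)) \<longlonglongrightarrow> 0"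
    proof (rule Lim_null_comparison)
      have "\<bar>S (Suc n) x - S 0 x\<bar> \<le> 2 * K powr (1 / p)" for n
        using lp_ball_pointwise_bound[OF S, of "Suc n" x] lp_ball_pointwise_bound[OF S, of 0 x] assms(1)
        by linarith
      then show "\<forall>\<^sub>F n in sequentially. norm ((S (Suc n) x - S 0 x) / real (Suc n))
          \<le> (2 * K powr (1 / p)) * inverse (real (Suc n))"
        by (simp add: divide_inverse abs_mult mult_right_mono)
      show "(\<lambda>n. (2 * K powr (1 / p)) * inverse (real (Suc n))) \<longlonglongrightarrow> 0"
        using tendsto_mult_right_zero[OF LIMSEQ_inverse_real_of_nat] by blast
    qed
    then have "(\<lambda>n. M n x - M n (inv t \<otimes> x)) \<longlonglongrightarrow> S 1 x - 0"
      unfolding eq by (intro tendsto_diff tendsto_const)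
    from LIMSEQ_subseq_LIMSEQ[OF this k]
    have "(\<lambda>n. M (k n) x - M (k n) (inv t \<otimes> x)) \<longlonglongrightarrow> S 1 x"
      by (simp add: o_def)
    moreover have "(\<lambda>n. M (k n) x - M (k n) (inv t \<otimes> x)) \<longlonglongrightarrow> v x - v (inv t \<otimes> x)"
      using x t by (intro tendsto_diff lim) auto
    ultimately show ?thesis using LIMSEQ_unique by blast
  qed
  have "S n x = v x - v (inv (t [^] n) \<otimes> x)" if "x \<in> carrier G" for n x
    using that
  proof (induction n arbitrary: x)
    case 0
    \<comment> \<open>At the point \<open>t \<otimes> x\<close> with \<open>n = 0\<close> the
      recursion reads \<open>S 1 = S 1 + S 0\<close>, where the last term is evaluated at
      \<open>x\<close>.\<close>
    have "S 0 x = 0" using rec[of "t \<otimes> x" 0] 0 t by (simp add: m_assoc[symmetric])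
    then show ?case using 0 by simp
  next
    case (Suc n)
    have "inv (t [^] Suc n) \<otimes> x = inv (t [^] n) \<otimes> (inv t \<otimes> x)"
      by (rule inv_pow_Suc_mult[OF t Suc.prems])
    then show ?case
      using rec[OF Suc.prems, of n] Suc.IH[of "inv t \<otimes> x"] one[OF Suc.prems] t Suc.prems by simp
  qed
  with v that show ?thesis by blast
qed

section \<open>Powers and normal forms in a free product\<close>

lemma (in group) pow_mult_shift:
  assumes "a \<in> carrier G" "b \<in> carrier G"
  shows "(a \<otimes> b) [^] (r::nat) \<otimes> a = a \<otimes> (b \<otimes> a) [^] r"
proof (induction r)
  case (Suc r)
  have "(a \<otimes> b) [^] Suc r \<otimes> a = ((a \<otimes> b) [^] r \<otimes> a) \<otimes> (b \<otimes> a)"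
    using assms by (simp add: m_assoc)
  also have "\<dots> = a \<otimes> (b \<otimes> a) [^] Suc r"
    unfolding Suc.IH using assms by (simp add: m_assoc)
  finally show ?case .
qed (use assms in simp)

lemma (in group) nat_pow_inj_of_infinite_order:
  assumes "g \<in> carrier G" "\<And>n::nat. 0 < n \<Longrightarrow> g [^] n \<noteq> \<one>" "g [^] (i::nat) = g [^] (j::nat)"
  shows "i = j"
proof -
  have *: "\<not> i < j" if "g [^] i = g [^] j" for i j :: nat
  proof
    assume "i < j"
    then obtain d where d: "0 < d" "j = i + d" by (metis less_imp_add_positive)
    with that have "g [^] i \<otimes> g [^] d = g [^] i" using assms(1) by (metis nat_pow_mult)
    then have "g [^] d = \<one>" using assms(1) by (metis l_cancel_one nat_pow_closed)
    with assms(2) d(1) show False by blast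
  qed
  show ?thesis using *[of i j] *[of j i] assms(3) by simp
qed

lemma (in group) subgroup_nat_pow_closed:
  assumes "subgroup H G" "g \<in> H"
  shows "g [^] (n::nat) \<in> H"
  by (induction n) (use assms in \<open>auto simp: subgroup.one_closed subgroup.m_closed\<close>)

lemma (in group) word_prod_closed:
  assumes "set w \<subseteq> carrier G \<times> carrier G"
  shows "word_prod G w \<in> carrier G"
  using assms by (induction w) auto

lemma (in group) word_prod_append:
  assumes "set u \<subseteq> carrier G \<times> carrier G" "set w \<subseteq> carrier G \<times> carrier G"
  shows "word_prod G (u @ w) = word_prod G u \<otimes> word_prod G w"
  using assms
proof (induction u)
  case (Cons ab u)
  then show ?case by (cases ab) (auto simp: m_assoc word_prod_closed)
qed (simp add: word_prod_closed)

lemma (in group) word_prod_replicate: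
  assumes "a \<in> carrier G" "b \<in> carrier G"
  shows "word_prod G (replicate k (a, b)) = (a \<otimes> b) [^] k"
proof (induction k)
  case (Suc k)
  then have "word_prod G (replicate (Suc k) (a, b)) = a \<otimes> b \<otimes> (a \<otimes> b) [^] k"
    using assms by (simp add: m_assoc)
  also have "\<dots> = (a \<otimes> b) [^] Suc k"
    using assms by (intro nat_pow_Suc2[symmetric]) simp
  finally show ?case .
qed simp

lemma nf_word_replicate:
  assumes "a \<in> A" "a \<noteq> \<one>\<^bsub>G\<^esub>" "b \<in> B" "b \<noteq> \<one>\<^bsub>G\<^esub>" "0 < k"
  shows "nf_word G A B (replicate k (a, b))"
  using assms by (auto simp: nf_word_def)

lemma (in group) free_product_subset:
  assumes "free_product G A B"
  shows "A \<subseteq> carrier G" "B \<subseteq> carrier G"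
  using assms by (auto simp: free_product_def subgroup.subset)

lemma (in group) free_product_pow_ne_one:
  assumes fp: "free_product G A B" and "a \<in> A" "a \<noteq> \<one>" "b \<in> B" "b \<noteq> \<one>" "0 < (k::nat)"
  shows "(a \<otimes> b) [^] k \<noteq> \<one>"
proof -
  have "a \<in> carrier G" "b \<in> carrier G"
    using assms free_product_subset[OF fp] by auto
  then show ?thesis
    using fp nf_word_replicate[of a A G b B k] assms word_prod_replicate[of a b k]
    by (auto simp: free_product_def)
qed

text \<open>The power starts in \<open>B\<close> and ends in \<open>A\<close>, so its normal form
  ends with the pair \<open>(a, \<one>)\<close>, and uniqueness of normal forms recovers
  \<open>a\<close>.\<close>

lemma (in group) free_product_pow_inj:
  assumes fp: "free_product G A B"
    and a: "a \<in> A" "a \<noteq> \<one>" "a' \<in> A" "a' \<noteq> \<one>" and b: "b \<in> B" "b \<noteq> \<one>" and "0 < (r::nat)"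
    and eq: "(b \<otimes> a) [^] r = (b \<otimes> a') [^] r"
  shows "a = a'"
proof -
  obtain s where r: "r = Suc s" using \<open>0 < r\<close> by (cases r) auto
  \<comment> \<open>This encodes \<open>b (a b)^s a = (b a)^r\<close> with \<open>s = r - 1\<close>.
    The padding by \<open>\<one>\<close> sits in the first slot for \<open>A\<close> and the last
    slot for \<open>B\<close>, the only places where a normal form admits it.\<close>
  define W where "W a = (\<one>, b) # replicate s (a, b) @ [(a, \<one>)]" for a
  have car: "A \<subseteq> carrier G" "B \<subseteq> carrier G" using free_product_subset[OF fp] .
  have sg: "subgroup A G" "subgroup B G" using fp by (auto simp: free_product_def)
  have nf: "nf_word G A B (W a)" if "a \<in> A" "a \<noteq> \<one>" for a
    using that b subgroup.one_closed[OF sg(1)] subgroup.one_closed[OF sg(2)]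
    by (auto simp: nf_word_def W_def nth_Cons nth_append split: nat.splits)
  have pr: "word_prod G (W a) = (b \<otimes> a) [^] r" if "a \<in> A" for a
  proof -
    have ab: "a \<in> carrier G" "b \<in> carrier G" using that b car by auto
    have "word_prod G (W a) = b \<otimes> ((a \<otimes> b) [^] s \<otimes> a)"
      using ab word_prod_append[of "replicate s (a, b)" "[(a, \<one>)]"]
      by (simp add: W_def word_prod_replicate set_replicate_conv_if)
    also have "\<dots> = (b \<otimes> a) \<otimes> (b \<otimes> a) [^] s"
      using ab by (simp add: pow_mult_shift m_assoc)
    also have "\<dots> = (b \<otimes> a) [^] r"
      unfolding r using ab by (intro nat_pow_Suc2[symmetric]) simp
    finally show ?thesis .
  qed
  have "(b \<otimes> a) [^] r \<noteq> \<one>"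
    using fp nf[OF a(1,2)] pr[OF a(1)] by (auto simp: free_product_def)
  moreover have "(b \<otimes> a) [^] r \<in> carrier G" using a b car by auto
  ultimately have "\<exists>!w. nf_word G A B w \<and> word_prod G w = (b \<otimes> a) [^] r"
    using fp by (auto simp: free_product_def)
  then have "W a = W a'"
    using nf pr a eq by metis
  then show ?thesis by (simp add: W_def)
qed

section \<open>Values of the split quasicocycle\<close>

lemma (in group) split_qc_eq_split_word:
  assumes fp: "free_product G A B" and nf: "nf_word G A B w" and w: "set w \<subseteq> carrier G \<times> carrier G"
  shows "split_qc G A B fA fB (word_prod G w) = split_word G fA fB w"
proof -
  have ne: "word_prod G w \<noteq> \<one>" using fp nf by (auto simp: free_product_def)
  then have "\<exists>!w'. nf_word G A B w' \<and> word_prod G w' = word_prod G w"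
    using fp word_prod_closed[OF w] by (auto simp: free_product_def)
  then have "(THE w'. nf_word G A B w' \<and> word_prod G w' = word_prod G w) = w"
    using nf by (intro the1_equality) auto
  with ne show ?thesis by (simp add: split_qc_def)
qed

text \<open>The single pair \<open>(a, b)\<close> is a normal form unless both entries are trivial.
  In that case \<open>split_qc\<close> is 0 by definition, which must agree with
  \<open>f \<one>\<close>.\<close>

lemma (in group) split_qc_syllable:
  assumes fp: "free_product G A B" and a: "a \<in> A" and b: "b \<in> B" and "f \<one> = (\<lambda>x. 0)"
  shows "split_qc G A B f (\<lambda>_ _. 0) (a \<otimes> b) = f a"
proof (cases "a = \<one> \<and> b = \<one>")
  case True
  then show ?thesis using assms by (simp add: split_qc_def)
next
  case False
  have "a \<in> carrier G" "b \<in> carrier G" using a b free_product_subset[OF fp] by auto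
  moreover have "nf_word G A B [(a, b)]" using False a b by (auto simp: nf_word_def)
  ultimately show ?thesis
    using split_qc_eq_split_word[OF fp, of "[(a, b)]" f "\<lambda>_ _. 0"] by (simp add: lreg_act_def)
qed

text \<open>The normal form is \<open>k\<close> copies of \<open>(a, b)\<close>. Each copy
  contributes \<open>f a\<close>, translated by the prefix \<open>(a b)^i\<close> before it, and the
  zero map on \<open>B\<close> contributes nothing.\<close>

lemma (in group) split_qc_pow:
  assumes fp: "free_product G A B" and a: "a \<in> A" "a \<noteq> \<one>" and b: "b \<in> B" "b \<noteq> \<one>"
    and x: "x \<in> carrier G"
  shows "split_qc G A B f (\<lambda>_ _. 0) ((a \<otimes> b) [^] (k::nat)) x
    = (\<Sum>i<k. f a (inv ((a \<otimes> b) [^] i) \<otimes> x))"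
proof (cases "k = 0")
  case True
  then show ?thesis by (simp add: split_qc_def)
next
  case False
  have ab: "a \<in> carrier G" "b \<in> carrier G" using a b free_product_subset[OF fp] by auto
  have "split_word G f (\<lambda>_ _. 0) (replicate k (a, b)) x = (\<Sum>i<k. f a (inv ((a \<otimes> b) [^] i) \<otimes> x))"
    using x
  proof (induction k arbitrary: x)
    case (Suc k)
    have shift: "inv ((a \<otimes> b) [^] Suc i) \<otimes> x = inv ((a \<otimes> b) [^] i) \<otimes> (inv (a \<otimes> b) \<otimes> x)" for i
      using ab Suc.prems by (intro inv_pow_Suc_mult) auto
    have "split_word G f (\<lambda>_ _. 0) (replicate (Suc k) (a, b)) x
        = f a x + (\<Sum>i<k. f a (inv ((a \<otimes> b) [^] i) \<otimes> (inv (a \<otimes> b) \<otimes> x)))"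
      using Suc.IH[of "inv (a \<otimes> b) \<otimes> x"] Suc.prems ab by (simp add: lreg_act_def)
    also have "\<dots> = (\<Sum>i<Suc k. f a (inv ((a \<otimes> b) [^] i) \<otimes> x))"
      unfolding sum.lessThan_Suc_shift shift using Suc.prems by simp
    finally show ?case .
  qed simp
  then show ?thesis
    using split_qc_eq_split_word[OF fp nf_word_replicate[of a A G b B k], of f "\<lambda>_ _. 0"]
      a b ab False word_prod_replicate[OF ab, of k] by auto
qed

section \<open>Cocycles at bounded distance from a split quasicocycle\<close>

lemma (in group) cocycle_pow:
  assumes cocycle: "\<And>g h x. \<lbrakk>g \<in> carrier G; h \<in> carrier G; x \<in> carrier G\<rbrakk>
      \<Longrightarrow> c (g \<otimes> h) x = c g x + c h (inv g \<otimes> x)"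
    and "g \<in> carrier G" "x \<in> carrier G"
  shows "c (g [^] (k::nat)) x = (\<Sum>i<k. c g (inv (g [^] i) \<otimes> x) :: real)"
proof (induction k)
  case 0
  show ?case using cocycle[of \<one> \<one> x] assms by simp
next
  case (Suc k)
  then show ?case using cocycle[of "g [^] k" g x] assms by simp
qed

text \<open>The points \<open>(a b)\<^sup>i a y\<close> with \<open>i < k\<close> lie in translates of \<open>u\<close> that are nearly
  disjoint as soon as \<open>a\<close> is chosen far out, so the sum of the translates has large norm.\<close>

lemma (in group) bounded_translate_sums_imp_zero:
  fixes u :: "'a \<Rightarrow> real" and W :: "nat \<Rightarrow> nat \<Rightarrow> 'a \<Rightarrow> real" and N :: nat
  assumes fp: "free_product G A B" and "p \<ge> 1"
    and t: "t \<in> A" "\<And>n::nat. 0 < n \<Longrightarrow> t [^] n \<noteq> \<one>" and b: "b \<in> B" "b \<noteq> \<one>"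
    and u: "u \<in> lp_ball G p L"
    and W: "\<And>m k. N < m \<Longrightarrow> W m k \<in> lp_ball G p K"
    and W_eq: "\<And>m k x. \<lbrakk>N < m; x \<in> carrier G\<rbrakk>
      \<Longrightarrow> W m k x = (\<Sum>j<k. u (inv (t [^] m) \<otimes> (inv ((t [^] m \<otimes> b) [^] j) \<otimes> x)))"
    and y: "y \<in> carrier G"
  shows "u y = 0"
proof (rule ccontr)
  assume "u y \<noteq> 0"
  have car: "t \<in> carrier G" "b \<in> carrier G" using t b free_product_subset[OF fp] by auto
  have sgA: "subgroup A G" using fp by (simp add: free_product_def)
  have tA: "t [^] (m::nat) \<in> A" for m
    by (rule subgroup_nat_pow_closed[OF sgA t(1)])
  \<comment> \<open>Each peak of \<open>W m k\<close> will contribute at least \<open>e\<close> to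
    the sum of p-th powers, so \<open>k\<close> peaks with \<open>K < k * e\<close> exceed the
    radius. This fixes \<open>k\<close> before \<open>m\<close> is chosen.\<close>
  define e where "e = (\<bar>u y\<bar> / 2) powr p"
  have "0 < e" using \<open>u y \<noteq> 0\<close> by (simp add: e_def)
  then obtain k :: nat where k: "K < real k * e"
    using reals_Archimedean3 by blast
  have "0 \<le> K" using W[of "Suc N" 0] lp_ball_radius_nonneg by blast
  then have "0 < k" using k by (cases k) auto
  \<comment> \<open>With this threshold, fewer than \<open>k\<close> off-peak terms add up to at
    most half of \<open>\<bar>u y\<bar>\<close>.\<close>
  define Z where "Z = {x \<in> carrier G. \<bar>u y\<bar> / (2 * k) \<le> \<bar>u x\<bar>}"
  have "finite Z"
    unfolding Z_def using \<open>u y \<noteq> 0\<close> \<open>0 < k\<close> \<open>p \<ge> 1\<close>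
    by (intro lp_ball_finite_superlevel[OF u]) auto
  \<comment> \<open>\<open>q m\<close> is conjugate to \<open>t^m b\<close> by \<open>t^m\<close>;
    its powers measure the displacement between peaks.\<close>
  define q where "q m = b \<otimes> t [^] (m::nat)" for m
  have qc: "q m \<in> carrier G" for m using car by (simp add: q_def)
  have inj_t: "m = m'" if "t [^] m = t [^] m'" for m m' :: nat
    using nat_pow_inj_of_infinite_order[OF car(1) t(2) that] .
  have inj_q: "m = m'" if "0 < m" "0 < m'" "0 < r" "q m [^] r = q m' [^] r" for m m' r :: nat
    using free_product_pow_inj[OF fp, of "t [^] m" "t [^] m'" b r] that tA t(2) b inj_t
    by (auto simp: q_def)
  \<comment> \<open>These are the exponents for which a displacement by \<open>r\<close> peaks
    carries \<open>y\<close> to a large value of \<open>u\<close>. As \<open>m\<close> determines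
    the displaced point injectively and \<open>Z\<close> is finite, only finitely many are bad for
    each \<open>r\<close>.\<close>
  define bad where "bad r = {m. 0 < m \<and> (q m [^] r \<otimes> y \<in> Z \<or> inv (q m [^] r) \<otimes> y \<in> Z)}" for r :: nat
  have "finite (bad r)" if "0 < r" for r
  proof -
    have "inj_on (\<lambda>m. q m [^] r \<otimes> y) {0<..}"
      using inj_q that y qc by (auto intro!: inj_onI)
    then have "finite {m \<in> {0<..}. q m [^] r \<otimes> y \<in> Z}"
      using \<open>finite Z\<close> finite_vimage_IntI[of Z "\<lambda>m. q m [^] r \<otimes> y" "{0<..}"]
      by (auto simp: vimage_def Int_def conj_commute)
    moreover have "inj_on (\<lambda>m. inv (q m [^] r) \<otimes> y) {0<..}"
    proof (rule inj_onI)
      fix m m' :: nat assume mm: "m \<in> {0<..}" "m' \<in> {0<..}" "inv (q m [^] r) \<otimes> y = inv (q m' [^] r) \<otimes> y"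
      then have "inv (q m [^] r) = inv (q m' [^] r)" using y qc by simp
      then have "q m [^] r = q m' [^] r" using qc by (metis inv_inv nat_pow_closed)
      with mm that show "m = m'" by (intro inj_q) auto
    qed
    then have "finite {m \<in> {0<..}. inv (q m [^] r) \<otimes> y \<in> Z}"
      using \<open>finite Z\<close> finite_vimage_IntI[of Z "\<lambda>m. inv (q m [^] r) \<otimes> y" "{0<..}"]
      by (auto simp: vimage_def Int_def conj_commute)
    ultimately have "finite ({m \<in> {0<..}. q m [^] r \<otimes> y \<in> Z} \<union> {m \<in> {0<..}. inv (q m [^] r) \<otimes> y \<in> Z})"
      by simp
    then show ?thesis by (rule finite_subset[rotated]) (auto simp: bad_def)
  qed
  then have "finite ((\<Union>r\<in>{0<..k}. bad r) \<union> {..N})" by simp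
  then obtain m where m: "N < m" "m \<notin> (\<Union>r\<in>{0<..k}. bad r)"
    using ex_new_if_finite[OF infinite_UNIV_nat] by (metis UnCI atMost_iff not_le)
  define a where "a = t [^] m"
  define g where "g = a \<otimes> b"
  have a: "a \<in> A" "a \<in> carrier G" "a \<noteq> \<one>" using tA t(2)[of m] car m by (auto simp: a_def)
  have gc: "g \<in> carrier G" using a car by (simp add: g_def)
  have far: "\<bar>u (q m [^] r \<otimes> y)\<bar> \<le> \<bar>u y\<bar> / (2 * k)" "\<bar>u (inv (q m [^] r) \<otimes> y)\<bar> \<le> \<bar>u y\<bar> / (2 * k)"
    if "0 < r" "r \<le> k" for r
  proof -
    have "m \<notin> bad r" "0 < m" using m that by auto
    then show "\<bar>u (q m [^] r \<otimes> y)\<bar> \<le> \<bar>u y\<bar> / (2 * k)" "\<bar>u (inv (q m [^] r) \<otimes> y)\<bar> \<le> \<bar>u y\<bar> / (2 * k)"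
      using qc y by (auto simp: bad_def Z_def)
  qed
  have shift: "inv a \<otimes> (g [^] r \<otimes> (a \<otimes> z)) = q m [^] r \<otimes> z" if "z \<in> carrier G" for r :: nat and z
  proof -
    have "g [^] r \<otimes> (a \<otimes> z) = a \<otimes> (q m [^] r \<otimes> z)"
      using pow_mult_shift[of a b r] a car that
      by (simp add: g_def q_def a_def[symmetric] m_assoc[symmetric])
    then show ?thesis using a qc that by (simp add: m_assoc[symmetric])
  qed
  \<comment> \<open>The position of the \<open>i\<close>-th peak, where the \<open>i\<close>-th
    translate of \<open>u\<close> takes the value \<open>u y\<close>.\<close>
  define pt where "pt i = g [^] i \<otimes> (a \<otimes> y)" for i :: nat
  have ptC: "pt i \<in> carrier G" for i using gc a y by (simp add: pt_def)
  have pow_add: "g [^] (i + r) = g [^] i \<otimes> g [^] r" for i r :: nat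
    using gc by (simp add: nat_pow_mult)
  \<comment> \<open>Seen from the \<open>j\<close>-th translate, the \<open>i\<close>-th peak lies
    at \<open>q^(i-j) y\<close>. Both signs occur, hence the inverse powers in
    \<open>bad\<close>.\<close>
  have small: "\<bar>u (inv a \<otimes> (inv (g [^] j) \<otimes> pt i))\<bar> \<le> \<bar>u y\<bar> / (2 * k)" if ij: "i < k" "j < k" "i \<noteq> j" for i j
  proof (cases "j < i")
    case True
    then obtain r where r: "i = j + r" "0 < r" by (metis less_imp_add_positive)
    have "inv (g [^] j) \<otimes> pt i = g [^] r \<otimes> (a \<otimes> y)"
      using gc a y by (simp add: pt_def r pow_add m_assoc[symmetric])
    then show ?thesis using shift[OF y] far(1)[of r] r ij by simp
  next
    case False
    then obtain r where r: "j = i + r" "0 < r" using ij by (metis less_imp_add_positive linorder_neqE_nat)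
    let ?z = "inv (q m [^] r) \<otimes> y"
    have zc: "?z \<in> carrier G" using qc y by simp
    have "q m [^] r \<otimes> ?z = y" using qc y by (simp add: m_assoc[symmetric])
    then have "g [^] r \<otimes> (a \<otimes> ?z) = a \<otimes> y"
      using shift[OF zc, of r] gc a zc y by (metis inv_solve_left m_closed nat_pow_closed)
    then have "inv (g [^] r) \<otimes> (a \<otimes> y) = a \<otimes> ?z"
      using gc a zc y by (metis inv_solve_left m_closed nat_pow_closed)
    moreover have "inv (g [^] j) \<otimes> pt i = inv (g [^] r) \<otimes> (a \<otimes> y)"
    proof -
      have "inv (g [^] j) \<otimes> pt i = inv (g [^] r) \<otimes> (inv (g [^] i) \<otimes> (g [^] i \<otimes> (a \<otimes> y)))"
        using gc a y by (simp add: pt_def r pow_add inv_mult_group m_assoc)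
      also have "inv (g [^] i) \<otimes> (g [^] i \<otimes> (a \<otimes> y)) = a \<otimes> y"
        using gc a y by (simp add: m_assoc[symmetric])
      finally show ?thesis .
    qed
    ultimately have "inv a \<otimes> (inv (g [^] j) \<otimes> pt i) = ?z"
      using a zc by (simp add: m_assoc[symmetric])
    then show ?thesis using far(2)[of r] r ij by simp
  qed
  have low: "\<bar>u y\<bar> / 2 \<le> \<bar>W m k (pt i)\<bar>" if i: "i < k" for i
  proof -
    let ?T = "\<lambda>j. u (inv a \<otimes> (inv (g [^] j) \<otimes> pt i))"
    have "W m k (pt i) = (\<Sum>j<k. ?T j)"
      using W_eq[OF m(1) ptC] by (simp add: g_def a_def)
    also have "\<dots> = ?T i + (\<Sum>j\<in>{..<k} - {i}. ?T j)"
      using i by (subst sum.remove[of _ i]) auto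
    also have "?T i = u y"
      using gc a y by (simp add: pt_def m_assoc[symmetric])
    finally have W1: "W m k (pt i) = u y + (\<Sum>j\<in>{..<k} - {i}. ?T j)" .
    have "\<bar>\<Sum>j\<in>{..<k} - {i}. ?T j\<bar> \<le> (\<Sum>j\<in>{..<k} - {i}. \<bar>u y\<bar> / (2 * k))"
      using small i by (intro order_trans[OF sum_abs] sum_mono) auto
    also have "\<dots> \<le> (\<Sum>j<k. \<bar>u y\<bar> / (2 * k))"
      by (intro sum_mono2) auto
    also have "\<dots> = \<bar>u y\<bar> / 2" using \<open>0 < k\<close> by simp
    finally show ?thesis using W1 by linarith
  qed
  \<comment> \<open>As \<open>g\<close> has infinite order the peaks are distinct, so the lower
    bound \<open>low\<close> counts \<open>k\<close> times.\<close>
  have "inj_on pt {..<k}"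
  proof (rule inj_onI)
    fix i j assume "pt i = pt j"
    then have "g [^] i = g [^] j" using gc a y by (simp add: pt_def)
    then show "i = j"
      using nat_pow_inj_of_infinite_order[OF gc] free_product_pow_ne_one[OF fp a(1,3) b]
      by (auto simp: g_def)
  qed
  then have "real k * (\<bar>u y\<bar> / 2) powr p \<le> K"
    using lp_ball_card_le[OF W[OF m(1)], of "pt ` {..<k}" "\<bar>u y\<bar> / 2" k] low ptC \<open>p \<ge> 1\<close>
    by (auto simp: card_image)
  with k show False by (simp add: e_def)
qed

text \<open>Two kinds of powers of \<open>t\<close> are used: those beyond \<open>N\<close>, where
  \<open>f\<close> vanishes, control the value of the cocycle at \<open>b\<close>, and the power
  \<open>l\<close>, where \<open>f\<close> is a point mass of weight \<open>r\<close>, then detects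
  \<open>r\<close>.\<close>

lemma (in group) split_qc_near_cocycle_imp_zero:
  fixes N l :: nat
  assumes fp: "free_product G A B" and "p \<ge> 1" and "countable (carrier G)"
    and t: "t \<in> A" "\<And>n::nat. 0 < n \<Longrightarrow> t [^] n \<noteq> \<one>" and b: "b \<in> B" "b \<noteq> \<one>"
    and f_one: "f \<one> = (\<lambda>x. 0)" and f_bd: "\<And>a. a \<in> A \<Longrightarrow> f a \<in> lp_ball G p L"
    and f_fin: "\<And>m. N < m \<Longrightarrow> f (t [^] m) = (\<lambda>x. 0)"
    and f_l: "0 < l" "f (t [^] l) = (\<lambda>x. if x = \<one> then r else 0)"
    and cocycle: "\<And>g h x. \<lbrakk>g \<in> carrier G; h \<in> carrier G; x \<in> carrier G\<rbrakk>
      \<Longrightarrow> c (g \<otimes> h) x = c g x + c h (inv g \<otimes> x)"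
    and near: "\<And>g. g \<in> carrier G
      \<Longrightarrow> (\<lambda>x. split_qc G A B f (\<lambda>_ _. 0) g x - c g x) \<in> lp_ball G p K"
  shows "r = 0"
proof -
  let ?F = "split_qc G A B f (\<lambda>_ _. 0)"
  have car: "t \<in> carrier G" "b \<in> carrier G" using t b free_product_subset[OF fp] by auto
  have sg: "subgroup A G" "subgroup B G" using fp by (auto simp: free_product_def)
  have tA: "t [^] (m::nat) \<in> A" for m
    by (rule subgroup_nat_pow_closed[OF sg(1) t(1)])
  have p0: "p \<ge> 0" using \<open>p \<ge> 1\<close> by simp
  define S where "S n = c (t [^] n)" for n :: nat
  \<comment> \<open>On the powers of \<open>t\<close> the split quasicocycle is just
    \<open>f\<close>, which is bounded; hence so is \<open>c\<close>.\<close>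
  have S: "S n \<in> lp_ball G p (2 powr p * (L + K))" for n
  proof -
    have "?F (t [^] n) = f (t [^] n)"
      using split_qc_syllable[where f = f, OF fp tA[of n] subgroup.one_closed[OF sg(2)] f_one] car by simp
    then show ?thesis
      using lp_ball_diff[OF f_bd[OF tA] near[of "t [^] n"] p0, of n] car by (simp add: S_def)
  qed
  have rec: "S (Suc n) x = S 1 x + S n (inv t \<otimes> x)" if "x \<in> carrier G" for n x
    unfolding S_def nat_pow_Suc2[OF car(1)] using cocycle[of t "t [^] n" x] car that by simp
  obtain v where v: "v \<in> lp_ball G p (2 powr p * (L + K))"
    and Sv: "\<And>n x. x \<in> carrier G \<Longrightarrow> S n x = v x - v (inv (t [^] n) \<otimes> x)"
  proof (rule bounded_cyclic_cocycle_inner[of p t S, OF \<open>p \<ge> 1\<close> \<open>countable _\<close> car(1) S rec])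
    fix v assume "v \<in> lp_ball G p (2 powr p * (L + K))"
      and "\<And>n x. x \<in> carrier G \<Longrightarrow> S n x = v x - v (inv (t [^] n) \<otimes> x)"
    then show thesis by (rule that)
  qed
  \<comment> \<open>Subtracting the coboundary of \<open>v\<close> keeps the cocycle identity, makes
    \<open>c'\<close> vanish on the powers of \<open>t\<close>, and changes the distance to
    \<open>?F\<close> by a bounded amount only.\<close>
  define c' where "c' g x = c g x - (v x - lreg_act G g v x)" for g x
  have coc: "c' (g \<otimes> h) x = c' g x + c' h (inv g \<otimes> x)"
    if "g \<in> carrier G" "h \<in> carrier G" "x \<in> carrier G" for g h x
    using that by (simp add: c'_def cocycle lreg_act_def inv_mult_group m_assoc)
  have ct: "c' (t [^] m) x = 0" if "x \<in> carrier G" for m :: nat and x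
    using Sv[OF that, of m] that by (simp add: c'_def S_def lreg_act_def)
  have c_tb: "c' (t [^] m \<otimes> b) x = c' b (inv (t [^] m) \<otimes> x)" if "x \<in> carrier G" for m :: nat and x
    using coc[of "t [^] m" b x] ct[OF that] car that by simp
  obtain K' where D: "\<And>g. g \<in> carrier G \<Longrightarrow> (\<lambda>x. ?F g x - c' g x) \<in> lp_ball G p K'"
  proof
    fix g assume g: "g \<in> carrier G"
    let ?L = "2 powr p * (L + K)"
    have "(\<lambda>x. (?F g x - c g x) + (v x - lreg_act G g v x)) \<in> lp_ball G p (2 powr p * (K + 2 powr p * (?L + ?L)))"
      by (intro lp_ball_add near lp_ball_diff v lp_ball_translate g p0)
    then show "(\<lambda>x. ?F g x - c' g x) \<in> lp_ball G p (2 powr p * (K + 2 powr p * (?L + ?L)))"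
      by (simp add: c'_def algebra_simps)
  qed
  have cpow: "c' ((t [^] m \<otimes> b) [^] k) x
      = (\<Sum>j<k. c' b (inv (t [^] m) \<otimes> (inv ((t [^] m \<otimes> b) [^] j) \<otimes> x)))"
    if x: "x \<in> carrier G" for m k :: nat and x
  proof -
    have "c' ((t [^] m \<otimes> b) [^] k) x = (\<Sum>j<k. c' (t [^] m \<otimes> b) (inv ((t [^] m \<otimes> b) [^] j) \<otimes> x))"
      by (rule cocycle_pow[OF coc]) (use car x in auto)
    also have "\<dots> = (\<Sum>j<k. c' b (inv (t [^] m) \<otimes> (inv ((t [^] m \<otimes> b) [^] j) \<otimes> x)))"
      by (intro sum.cong refl c_tb) (use car x in auto)
    finally show ?thesis .
  qed
  have cb: "c' b x = 0" if x: "x \<in> carrier G" for x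
  proof -
    \<comment> \<open>The sign makes \<open>u\<close> equal to \<open>?F b - c' b\<close>, as
      \<open>?F b = f \<one> = 0\<close>. For \<open>m\<close> beyond \<open>N\<close> the
      difference \<open>?F - c'\<close> at \<open>(t^m b)^k\<close> is then exactly a sum of
      translates of \<open>u\<close>.\<close>
    define u where "u = (\<lambda>x. - c' b x)"
    have "?F b = f \<one>"
      using split_qc_syllable[where f = f, OF fp subgroup.one_closed[OF sg(1)] b(1) f_one] car by simp
    then have u: "u \<in> lp_ball G p K'"
      using D[OF car(2)] by (simp add: f_one u_def)
    have "u x = 0"
    proof (rule bounded_translate_sums_imp_zero[OF fp \<open>p \<ge> 1\<close> t b u _ _ x])
      fix m k :: nat
      assume m: "N < m"
      show "(\<lambda>x. ?F ((t [^] m \<otimes> b) [^] k) x - c' ((t [^] m \<otimes> b) [^] k) x) \<in> lp_ball G p K'"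
        using car by (intro D) auto
      fix x assume x: "x \<in> carrier G"
      have "?F ((t [^] m \<otimes> b) [^] k) x = 0"
        using split_qc_pow[OF fp tA t(2) b x, of m f k] f_fin[OF m] m by simp
      then show "?F ((t [^] m \<otimes> b) [^] k) x - c' ((t [^] m \<otimes> b) [^] k) x
          = (\<Sum>j<k. u (inv (t [^] m) \<otimes> (inv ((t [^] m \<otimes> b) [^] j) \<otimes> x)))"
        by (simp add: cpow[OF x] u_def sum_negf)
    qed
    then show ?thesis by (simp add: u_def)
  qed
  define g where "g = t [^] l \<otimes> b"
  have gc: "g \<in> carrier G" using car by (simp add: g_def)
  have g_pow: "g [^] n \<noteq> \<one>" if "0 < n" for n :: nat
    unfolding g_def by (rule free_product_pow_ne_one[OF fp tA t(2)[OF f_l(1)] b that])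
  have inj: "inj_on (\<lambda>i::nat. g [^] i) {..<k}" for k
    by (intro inj_onI nat_pow_inj_of_infinite_order[OF gc g_pow])
  \<comment> \<open>Now \<open>c'\<close> vanishes on all powers of \<open>g\<close>, and at
    \<open>g^i\<close> only the \<open>i\<close>-th translate of the point mass is seen.\<close>
  have val: "?F (g [^] k) (g [^] i) - c' (g [^] k) (g [^] i) = r" if i: "i < k" for i k :: nat
  proof -
    have xc: "g [^] i \<in> carrier G" using gc by simp
    have "c' (g [^] k) (g [^] i) = 0"
      unfolding g_def cpow[OF xc[unfolded g_def]]
      by (intro sum.neutral ballI cb) (use car in auto)
    moreover have "?F (g [^] k) (g [^] i) = (\<Sum>j<k. f (t [^] l) (inv (g [^] j) \<otimes> g [^] i))"
      unfolding g_def by (rule split_qc_pow[OF fp tA t(2)[OF f_l(1)] b xc[unfolded g_def]])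
    moreover have "\<dots> = (\<Sum>j<k. if j = i then r else 0)"
    proof (intro sum.cong refl)
      fix j :: nat
      have "inv (g [^] j) \<otimes> g [^] i = \<one> \<longleftrightarrow> g [^] i = g [^] j"
        using gc inv_solve_left'[of "\<one>" "g [^] j" "g [^] i"] by simp
      also have "\<dots> \<longleftrightarrow> j = i"
        using nat_pow_inj_of_infinite_order[OF gc g_pow] by blast
      finally show "f (t [^] l) (inv (g [^] j) \<otimes> g [^] i) = (if j = i then r else 0)"
        by (simp add: f_l(2))
    qed
    ultimately show ?thesis using i by simp
  qed
  \<comment> \<open>The \<open>k\<close> distinct points \<open>g^i\<close> each carry the value
    \<open>r\<close>, while \<open>K'\<close> does not depend on \<open>k\<close>.\<close>
  have bound: "real k * \<bar>r\<bar> powr p \<le> K'" for k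
  proof -
    have "real (card ((\<lambda>i::nat. g [^] i) ` {..<k})) * \<bar>r\<bar> powr p \<le> K'"
      using val gc p0 by (intro lp_ball_card_le[OF D[of "g [^] k"]]) auto
    then show ?thesis by (simp add: card_image[OF inj])
  qed
  show ?thesis
  proof (rule ccontr)
    assume "r \<noteq> 0"
    then have "0 < \<bar>r\<bar> powr p" by simp
    then obtain k :: nat where "K' < real k * \<bar>r\<bar> powr p"
      using reals_Archimedean3 by blast
    with bound[of k] show False by simp
  qed
qed

section \<open>Linearity in the pair and the subspace property\<close>

lemma split_word_linear:
  "split_word G (\<lambda>g x. c * fA g x + d * fA' g x) (\<lambda>g x. c * fB g x + d * fB' g x) w x
    = c * split_word G fA fB w x + d * split_word G fA' fB' w x"
  by (induction w arbitrary: x) (auto simp: lreg_act_def algebra_simps)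

lemma split_class_linear:
  "split_class G A B (\<lambda>g x. c * fA g x + d * fA' g x) (\<lambda>g x. c * fB g x + d * fB' g x) g h x
    = c * split_class G A B fA fB g h x + d * split_class G A B fA' fB' g h x"
  by (auto simp: split_class_def qc_boundary_def split_qc_def split_word_linear lreg_act_def algebra_simps)

lemma split_qc_sum:
  "(\<Sum>i\<in>I. c i * split_qc G A B (F i) (\<lambda>_ _. 0) g x)
    = split_qc G A B (\<lambda>g x. \<Sum>i\<in>I. c i * F i g x) (\<lambda>_ _. 0) g x"
proof -
  have "(\<Sum>i\<in>I. c i * split_word G (F i) (\<lambda>_ _. 0) w x)
      = split_word G (\<lambda>g x. \<Sum>i\<in>I. c i * F i g x) (\<lambda>_ _. 0) w x" for w x
    by (induction w arbitrary: x)
      (auto simp: lreg_act_def algebra_simps sum.distrib simp flip: sum_distrib_left)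
  then show ?thesis by (simp add: split_qc_def)
qed

lemma (in group) quasicocycle_linear:
  assumes "subgroup H G" "p > 0" "quasicocycle G p H f" "quasicocycle G p H f'"
  shows "quasicocycle G p H (\<lambda>g x. c * f g x + d * f' g x)"
proof -
  define R where "R = \<bar>c\<bar> powr p"
  define R' where "R' = \<bar>d\<bar> powr p"
  have HG: "H \<subseteq> carrier G" using assms(1) by (rule subgroup.subset)
  have lp: "(\<lambda>x. c * u x + d * u' x) \<in> lp_ball G p (2 powr p * (R * K + R' * K'))"
    if "u \<in> lp_ball G p K" "u' \<in> lp_ball G p K'" for u u' K K'
    unfolding R_def R'_def using assms(2) by (intro lp_ball_add lp_ball_scale that) auto
  have dev: "\<exists>K. \<forall>g\<in>H. \<forall>h\<in>H. (\<lambda>x. f (g \<otimes> h) x - f g x - lreg_act G g (f h) x) \<in> lp_ball G p K"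
    if qc: "quasicocycle G p H f" for f
  proof -
    obtain C where C: "\<forall>g\<in>H. \<forall>h\<in>H. lp_norm G p (\<lambda>x. f (g \<otimes> h) x - f g x - lreg_act G g (f h) x) \<le> C"
      using qc by (auto simp: quasicocycle_def)
    have fl: "\<exists>K. f g \<in> lp_ball G p K" if "g \<in> H" for g
      using qc that lp_imp_lp_ball[of "f g" G p "lp_norm G p (f g)"] assms(2)
      by (auto simp: quasicocycle_def)
    \<comment> \<open>For a non-summable function the infinite sum is 0 by convention, and so is
      \<open>lp_norm\<close>. The bound \<open>C\<close> therefore says something only once the
      defect is known to lie in \<open>lp\<close>, which follows from its three terms.\<close>
    have "(\<lambda>x. f (g \<otimes> h) x - f g x - lreg_act G g (f h) x) \<in> lp_ball G p (\<bar>C\<bar> powr p)"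
      if gh: "g \<in> H" "h \<in> H" for g h
    proof (rule lp_imp_lp_ball)
      obtain K1 K2 K3 where "f (g \<otimes> h) \<in> lp_ball G p K1" "f g \<in> lp_ball G p K2" "f h \<in> lp_ball G p K3"
        using fl gh subgroup.m_closed[OF assms(1)] by meson
      then have "(\<lambda>x. f (g \<otimes> h) x - f g x - lreg_act G g (f h) x)
          \<in> lp_ball G p (2 powr p * (2 powr p * (K1 + K2) + K3))"
        using gh HG assms(2) by (intro lp_ball_diff lp_ball_translate) auto
      then show "(\<lambda>x. f (g \<otimes> h) x - f g x - lreg_act G g (f h) x) \<in> lp G p"
        using lp_ball_imp_lp assms(2) by blast
    qed (use C gh assms(2) in auto)
    then show ?thesis by blast
  qed
  obtain K K' where K: "\<And>g h. g \<in> H \<Longrightarrow> h \<in> H \<Longrightarrow>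
        (\<lambda>x. f (g \<otimes> h) x - f g x - lreg_act G g (f h) x) \<in> lp_ball G p K"
    and K': "\<And>g h. g \<in> H \<Longrightarrow> h \<in> H \<Longrightarrow>
        (\<lambda>x. f' (g \<otimes> h) x - f' g x - lreg_act G g (f' h) x) \<in> lp_ball G p K'"
    using dev[OF assms(3)] dev[OF assms(4)] by blast
  show ?thesis
    unfolding quasicocycle_def
  proof (intro conjI exI ballI)
    fix g assume g: "g \<in> H"
    have "f g \<in> lp G p" "f' g \<in> lp G p"
      using assms g by (auto simp: quasicocycle_def)
    then show "(\<lambda>x. c * f g x + d * f' g x) \<in> lp G p"
      using lp[OF lp_imp_lp_ball[OF _ order_refl assms(2)] lp_imp_lp_ball[OF _ order_refl assms(2)]]
        lp_ball_imp_lp(1)[OF _ assms(2)] by blast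
    fix h assume h: "h \<in> H"
    have "(\<lambda>x. c * f (g \<otimes> h) x + d * f' (g \<otimes> h) x - (c * f g x + d * f' g x)
          - lreg_act G g (\<lambda>x. c * f h x + d * f' h x) x)
        = (\<lambda>x. c * (f (g \<otimes> h) x - f g x - lreg_act G g (f h) x)
          + d * (f' (g \<otimes> h) x - f' g x - lreg_act G g (f' h) x))"
      by (auto simp: fun_eq_iff lreg_act_def algebra_simps)
    then show "lp_norm G p (\<lambda>x. c * f (g \<otimes> h) x + d * f' (g \<otimes> h) x - (c * f g x + d * f' g x)
          - lreg_act G g (\<lambda>x. c * f h x + d * f' h x) x)
        \<le> (2 powr p * (R * K + R' * K')) powr (1 / p)"
      using lp_ball_imp_lp(2)[OF lp[OF K[OF g h] K'[OF g h]] assms(2)] by simp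
  qed
qed

lemma alternating_linear:
  assumes "alternating G H f" "alternating G H f'"
  shows "alternating G H (\<lambda>g x. c * f g x + d * f' g x)"
proof -
  have "(c * f g x + d * f' g x) + lreg_act G g (\<lambda>x. c * f (inv\<^bsub>G\<^esub> g) x + d * f' (inv\<^bsub>G\<^esub> g) x) x = 0"
    if g: "g \<in> H" for g x
  proof -
    have "f g x + lreg_act G g (f (inv\<^bsub>G\<^esub> g)) x = 0" "f' g x + lreg_act G g (f' (inv\<^bsub>G\<^esub> g)) x = 0"
      using assms g by (auto simp: alternating_def dest: fun_cong)
    then have "c * (f g x + lreg_act G g (f (inv\<^bsub>G\<^esub> g)) x) + d * (f' g x + lreg_act G g (f' (inv\<^bsub>G\<^esub> g)) x) = 0"
      by simp
    then show ?thesis by (simp add: lreg_act_def algebra_simps split: if_splits)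
  qed
  then show ?thesis by (auto simp: alternating_def)
qed

lemma (in group) split_classes_form_subspace:
  assumes "free_product G A B" "p > 0"
  shows "split_classes_subspace G A B p"
  unfolding split_classes_subspace_def
proof (intro allI impI)
  fix fA fB fA' fB' and c d :: real
  assume H: "split_pair G A B p fA fB \<and> split_pair G A B p fA' fB'"
  \<comment> \<open>The same combination of the pairs is a witness: the difference of cochains is
    identically 0, hence the coboundary of 0.\<close>
  let ?hA = "\<lambda>g x. c * fA g x + d * fA' g x" and ?hB = "\<lambda>g x. c * fB g x + d * fB' g x"
  have "split_pair G A B p ?hA ?hB"
    using H assms by (auto simp: split_pair_def free_product_def intro: quasicocycle_linear alternating_linear)
  moreover have "bounded_exact G p (\<lambda>g h x. 0)"
    unfolding bounded_exact_def
    by (rule exI[of _ "\<lambda>_ _. 0"]) (auto simp: lp_def lp_norm_def lreg_act_def)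
  ultimately show "\<exists>hA hB. split_pair G A B p hA hB \<and>
      bounded_exact G p (\<lambda>g h x. split_class G A B hA hB g h x
        - (c * split_class G A B fA fB g h x + d * split_class G A B fA' fB' g h x))"
    by (intro exI[of _ ?hA] exI[of _ ?hB]) (simp add: split_class_linear)
qed

section \<open>Independent classes from point masses\<close>

lemma (in group) bounded_imp_quasicocycle:
  assumes "subgroup H G" "p > 0" and f: "\<And>g. g \<in> H \<Longrightarrow> f g \<in> lp_ball G p K"
  shows "quasicocycle G p H f"
  unfolding quasicocycle_def
proof (intro conjI exI ballI)
  fix g assume g: "g \<in> H"
  show "f g \<in> lp G p" using lp_ball_imp_lp(1)[OF f[OF g] assms(2)] .
  fix h assume h: "h \<in> H"
  have "(\<lambda>x. f (g \<otimes> h) x - f g x - lreg_act G g (f h) x)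
      \<in> lp_ball G p (2 powr p * (2 powr p * (K + K) + K))"
    using g h assms subgroup.m_closed[OF assms(1)] subgroup.mem_carrier[OF assms(1)]
    by (intro lp_ball_diff lp_ball_translate f) auto
  then show "lp_norm G p (\<lambda>x. f (g \<otimes> h) x - f g x - lreg_act G g (f h) x)
      \<le> (2 powr p * (2 powr p * (K + K) + K)) powr (1 / p)"
    using lp_ball_imp_lp(2) assms(2) by blast
qed

text \<open>The first term is the point mass at \<open>\<one>\<close>, placed on \<open>s\<close>.
  Alternation then forces the value on \<open>inv s\<close> to be minus its translate by
  \<open>inv s\<close>, which is the second term.\<close>

definition point_qc :: "('g, 'b) monoid_scheme \<Rightarrow> 'g \<Rightarrow> 'g \<Rightarrow> 'g \<Rightarrow> real" where
  "point_qc G s g x = of_bool (g = s \<and> x = \<one>\<^bsub>G\<^esub>) - of_bool (g = inv\<^bsub>G\<^esub> s \<and> x = inv\<^bsub>G\<^esub> s)"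

lemma (in group) point_qc_in_lp_ball:
  assumes "s \<in> carrier G" "p \<ge> 0"
  shows "point_qc G s g \<in> lp_ball G p 2"
proof -
  have "(\<Sum>x\<in>F. \<bar>point_qc G s g x\<bar> powr p) \<le> 2" if "finite F" for F
  proof -
    have "(\<Sum>x\<in>F. \<bar>point_qc G s g x\<bar> powr p) \<le> (\<Sum>x\<in>F. of_bool (x = \<one>) + of_bool (x = inv s))"
      by (intro sum_mono) (auto simp: point_qc_def of_bool_def)
    also have "\<dots> = (\<Sum>x\<in>F. if x = \<one> then 1 else 0) + (\<Sum>x\<in>F. if x = inv s then 1 else 0)"
      by (simp only: sum.distrib of_bool_def)
    also have "\<dots> \<le> 2" using that by simp
    finally show ?thesis .
  qed
  then show ?thesis using assms by (auto simp: lp_ball_def point_qc_def)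
qed

lemma (in group) alternating_point_qc:
  assumes "subgroup H G" "s \<in> carrier G"
  shows "alternating G H (point_qc G s)"
proof -
  have "point_qc G s g x + lreg_act G g (point_qc G s (inv g)) x = 0" if g: "g \<in> carrier G" for g x
  proof (cases "x \<in> carrier G")
    case True
    have e: "inv g = inv s \<longleftrightarrow> g = s" "inv g = s \<longleftrightarrow> g = inv s"
      using g assms(2) by (metis inv_inv, metis inv_inv)
    have l: "inv s \<otimes> x = inv s \<longleftrightarrow> x = \<one>"
      using True assms(2) by (metis inv_closed l_cancel_one)
    have r: "inv (inv s) \<otimes> x = \<one> \<longleftrightarrow> x = inv s"
      using True assms(2) by (metis inv_closed inv_inv inv_solve_left one_closed r_one)
    \<comment> \<open>Passing from \<open>g\<close>, \<open>x\<close> to \<open>inv g\<close>,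
      \<open>inv g \<otimes> x\<close> exchanges the two terms.\<close>
    have "point_qc G s (inv g) (inv g \<otimes> x) = - point_qc G s g x"
      unfolding point_qc_def e using l r by auto
    then show ?thesis using True by (simp add: lreg_act_def)
  next
    case False
    then show ?thesis using assms(2) by (auto simp: point_qc_def lreg_act_def)
  qed
  then show ?thesis
    using subgroup.mem_carrier[OF assms(1)] by (auto simp: alternating_def)
qed

text \<open>For point masses on distinct powers of \<open>t\<close>, a vanishing combination of
  classes says that one split quasicocycle is near a cocycle; the previous criterion then reads off
  each coefficient separately.\<close>

lemma (in group) split_classes_span_infinite_dim:
  assumes fp: "free_product G A B" and "p \<ge> 1" and "countable (carrier G)"
    and t: "t \<in> A" "\<And>n::nat. 0 < n \<Longrightarrow> t [^] n \<noteq> \<one>" and b: "b \<in> B" "b \<noteq> \<one>"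
  shows "split_classes_infinite_dim G A B p"
  unfolding split_classes_infinite_dim_def
proof (intro allI exI conjI impI)
  fix n i :: nat
  \<comment> \<open>The exponents start at 1, so that no mass sits on
    \<open>t^0 = \<one>\<close>.\<close>
  let ?FA = "\<lambda>i::nat. point_qc G (t [^] Suc i)" and ?FB = "\<lambda>(i::nat) _ _. 0 :: real"
  have sg: "subgroup A G" "subgroup B G" using fp by (auto simp: free_product_def)
  have car: "t \<in> carrier G" using t free_product_subset[OF fp] by auto
  have p: "p > 0" "p \<ge> 0" using \<open>p \<ge> 1\<close> by auto
  have FA: "?FA i g \<in> lp_ball G p 2" for i g
    using car p by (intro point_qc_in_lp_ball) auto
  have zero: "(\<lambda>x. 0) \<in> lp_ball G p 0" by (simp add: lp_ball_def)
  show "split_pair G A B p (?FA i) (?FB i)"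
    unfolding split_pair_def
  proof (intro conjI)
    show "quasicocycle G p A (?FA i)" by (rule bounded_imp_quasicocycle[OF sg(1) p(1) FA])
    show "alternating G A (?FA i)" using car by (intro alternating_point_qc[OF sg(1)]) simp
    show "quasicocycle G p B (?FB i)" by (rule bounded_imp_quasicocycle[OF sg(2) p(1) zero])
    show "alternating G B (?FB i)" by (simp add: alternating_def lreg_act_def)
  qed
  fix c :: "nat \<Rightarrow> real"
  assume "bounded_exact G p (\<lambda>g h x. \<Sum>i<n. c i * split_class G A B (?FA i) (?FB i) g h x)"
  then obtain \<beta> C where \<beta>: "\<And>g. g \<in> carrier G \<Longrightarrow> \<beta> g \<in> lp G p"
    and C: "\<And>g. g \<in> carrier G \<Longrightarrow> lp_norm G p (\<beta> g) \<le> C"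
    and ex: "\<And>g h. g \<in> carrier G \<Longrightarrow> h \<in> carrier G \<Longrightarrow>
      (\<lambda>x. \<Sum>i<n. c i * split_class G A B (?FA i) (?FB i) g h x)
        = (\<lambda>x. lreg_act G g (\<beta> h) x - \<beta> (g \<otimes> h) x + \<beta> g x)"
    unfolding bounded_exact_def by blast
  assume i: "i < n"
  define f where "f = (\<lambda>g x. \<Sum>i<n. c i * ?FA i g x)"
  let ?F = "split_qc G A B f (\<lambda>_ _. 0)"
  have F: "?F g x = (\<Sum>i<n. c i * split_qc G A B (?FA i) (?FB i) g x)" for g x
    by (simp only: split_qc_sum f_def)
  have inj: "t [^] j = t [^] k \<longleftrightarrow> j = k" for j k :: nat
    using nat_pow_inj_of_infinite_order[OF car t(2)] by blast
  \<comment> \<open>Nonnegative powers of \<open>t\<close> never meet inverses of positive ones, so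
    the mirrored half of \<open>point_qc\<close> is invisible on them.\<close>
  have ninv: "t [^] j \<noteq> inv (t [^] Suc k)" for j k :: nat
  proof
    assume eq: "t [^] j = inv (t [^] Suc k)"
    have "t [^] j \<otimes> t [^] Suc k = \<one>"
      unfolding eq by (rule l_inv) (use car in auto)
    then have "t [^] (j + Suc k) = \<one>"
      unfolding nat_pow_mult[OF car] .
    with t(2)[of "j + Suc k"] show False by simp
  qed
  have f_pow: "f (t [^] j) x = (\<Sum>k<n. if Suc k = j then c k * of_bool (x = \<one>) else 0)" for j :: nat and x
    unfolding f_def
  proof (intro sum.cong refl)
    fix k
    show "c k * ?FA k (t [^] j) x = (if Suc k = j then c k * of_bool (x = \<one>) else 0)"
      unfolding point_qc_def inj using ninv[of j k] by auto
  qed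
  \<comment> \<open>The radius may grow with the number of summands, but \<open>n\<close> is fixed;
    it must only be uniform in \<open>g\<close>.\<close>
  obtain L where L: "\<And>g. f g \<in> lp_ball G p L"
  proof -
    have "\<exists>L. \<forall>g. (\<lambda>x. \<Sum>i<k. c i * ?FA i g x) \<in> lp_ball G p L" for k
    proof (induction k)
      case 0
      show ?case using zero by auto
    next
      case (Suc k)
      then obtain L where L: "\<forall>g. (\<lambda>x. \<Sum>i<k. c i * ?FA i g x) \<in> lp_ball G p L" by blast
      then have "\<forall>g. (\<lambda>x. (\<Sum>i<k. c i * ?FA i g x) + c k * ?FA k g x)
          \<in> lp_ball G p (2 powr p * (L + \<bar>c k\<bar> powr p * 2))"
        using lp_ball_add lp_ball_scale[OF FA] p by blast
      then show ?case by auto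
    qed
    then show ?thesis using that unfolding f_def by blast
  qed
  \<comment> \<open>The cocycle is \<open>?F - \<beta>\<close>, at distance \<open>\<beta>\<close>
    from \<open>?F\<close>. Here \<open>N = n\<close> because the exponents in use are at most
    \<open>n\<close>, and \<open>l = Suc i\<close> carries the weight
    \<open>r = c i\<close>.\<close>
  show "c i = 0"
  proof (rule split_qc_near_cocycle_imp_zero[OF fp \<open>p \<ge> 1\<close> \<open>countable _\<close> t b])
    show "f \<one> = (\<lambda>x. 0)"
      using f_pow[of 0] by (auto simp: fun_eq_iff)
    show "f (t [^] m) = (\<lambda>x. 0)" if "n < m" for m
      using that by (auto simp: fun_eq_iff f_pow intro!: sum.neutral)
    show "0 < Suc i" by simp
    show "f (t [^] Suc i) = (\<lambda>x. if x = \<one> then c i else 0)"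
      unfolding fun_eq_iff f_pow using i by simp
    show "f a \<in> lp_ball G p L" for a by (rule L)
    show "(\<lambda>x. ?F g x - (?F g x - \<beta> g x)) \<in> lp_ball G p (\<bar>C\<bar> powr p)" if "g \<in> carrier G" for g
      using lp_imp_lp_ball[OF \<beta>[OF that] C[OF that] p(1)] by simp
    show "?F (g \<otimes> h) x - \<beta> (g \<otimes> h) x = (?F g x - \<beta> g x) + (?F h (inv g \<otimes> x) - \<beta> h (inv g \<otimes> x))"
      if "g \<in> carrier G" "h \<in> carrier G" "x \<in> carrier G" for g h x
    proof -
      have "?F g x + ?F h (inv g \<otimes> x) - ?F (g \<otimes> h) x
          = (\<Sum>i<n. c i * split_class G A B (?FA i) (?FB i) g h x)"
        using that(3) unfolding F
        by (simp add: split_class_def qc_boundary_def lreg_act_def algebra_simps sum.distrib sum_subtractf)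
      also have "\<dots> = \<beta> h (inv g \<otimes> x) - \<beta> (g \<otimes> h) x + \<beta> g x"
        using fun_cong[OF ex[OF that(1,2)], of x] that(3) by (simp add: lreg_act_def)
      finally show ?thesis by simp
    qed
  qed
qed

theorem theorem2p6:
  fixes G :: "'g monoid" and A B :: "'g set"
  assumes "group G"
    and "countable (carrier G)"
    and "free_product G A B"
    and "A \<noteq> {\<one>\<^bsub>G\<^esub>}" and "B \<noteq> {\<one>\<^bsub>G\<^esub>}"
    and "\<exists>a\<in>A. \<forall>n::nat. 0 < n \<longrightarrow> a [^]\<^bsub>G\<^esub> n \<noteq> \<one>\<^bsub>G\<^esub>"
  shows "(\<forall>p::real. 1 < p \<longrightarrow>
            split_classes_subspace G A B p \<and> split_classes_infinite_dim G A B p)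
       \<and> (amenable G A \<longrightarrow>
            split_classes_subspace G A B 1 \<and> split_classes_infinite_dim G A B 1)"
proof -
  interpret group G by fact
  obtain t where t: "t \<in> A" "\<And>n::nat. 0 < n \<Longrightarrow> t [^]\<^bsub>G\<^esub> n \<noteq> \<one>\<^bsub>G\<^esub>"
    using assms(6) by blast
  \<comment> \<open>Knowing that \<open>B\<close> contains the identity turns \<open>B\<close> being
    different from the trivial subgroup into the existence of a non-trivial element.\<close>
  have "\<one>\<^bsub>G\<^esub> \<in> B" using assms(3) by (auto simp: free_product_def subgroup.one_closed)
  then obtain b where b: "b \<in> B" "b \<noteq> \<one>\<^bsub>G\<^esub>" using assms(5) by blast
  have "split_classes_subspace G A B p \<and> split_classes_infinite_dim G A B p" if "p \<ge> 1" for p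
    using split_classes_form_subspace[OF assms(3)] split_classes_span_infinite_dim[OF assms(3) that assms(2) t b]
      that by simp
  then show ?thesis by simp
qed

end
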